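(* Let $n\ge2$, $R>0$ and let $S_R=\{x=(x',x_n): x'\in\mathbb{R}^{n-1},\ 0<x_n<2R\}$ be the infinite strip of inner radius $R$, with $d(x)=\operatorname{dist}(x,\mathbb{R}^n\setminus S_R)$. For every $s\ge1$ and $\gamma>1$ there is a constant $C\ge\gamma-1$ such that for all $u\in C_c^\infty(S_R)$ $$\int_{S_R}\frac{|\nabla u|}{d^{s-1}}dx\ge(s-1)\int_{S_R}\frac{|u|}{d^s}dx+\frac{C}{R^{s-1}}\int_{S_R}\frac{|u|}{d}X^\gamma\Big(\frac dR\Big)dx.$$ The last term is optimal in the sense that if $\gamma=1$ there is no constant $C>0$ such that this inequality holds for all $u\in C_c^\infty(S_R)$.
   Context: $X(t):=(1-\log t)^{-1}$ for $t\in(0,1]$, and $X^\gamma(t)=(X(t))^\gamma$. *)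

theory Defs
  imports "HOL-Analysis.Analysis"
begin

text \<open>
  Points of \<open>\<real>\<^sup>n\<close> are written as pairs \<open>(x', x\<^sub>n)\<close> in \<open>(real ^ 'm) \<times> real\<close>, with \<open>n = CARD('m) + 1\<close>.
  Index types are nonempty, so \<open>'m\<close> ranges exactly over the dimensions \<open>n \<ge> 2\<close>. The norm on the
  product is the Euclidean one and \<open>lborel\<close> on it is \<open>n\<close>-dimensional Lebesgue measure.
\<close>

definition strip :: "real \<Rightarrow> ((real ^ 'm) \<times> real) set" where
  "strip R = {(x', xn). 0 < xn \<and> xn < 2 * R}"

definition bdist :: "'a::metric_space set \<Rightarrow> 'a \<Rightarrow> real" where
  "bdist S x = infdist x (- S)"

definition X :: "real \<Rightarrow> real" where
  "X t = inverse (1 - ln t)"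

text \<open>
  The vector of partial derivatives; \<open>Basis\<close> is the standard orthonormal basis.
\<close>

definition grad :: "('a::euclidean_space \<Rightarrow> real) \<Rightarrow> 'a \<Rightarrow> 'a" where
  "grad u x = (\<Sum>b\<in>Basis. frechet_derivative u (at x) b *\<^sub>R b)"

primrec C_k :: "nat \<Rightarrow> ('a::euclidean_space \<Rightarrow> real) \<Rightarrow> bool" where
  "C_k 0 u \<longleftrightarrow> continuous_on UNIV u"
| "C_k (Suc k) u \<longleftrightarrow>
     u differentiable_on UNIV \<and> (\<forall>b\<in>Basis. C_k k (\<lambda>x. frechet_derivative u (at x) b))"

text \<open>
  Elements of \<open>C\<^sub>c\<^sup>\<infinity>(S)\<close>, for open \<open>S\<close>, are identified with their extensions by zero to the whole space.
\<close>

definition test_functions :: "'a::euclidean_space set \<Rightarrow> ('a \<Rightarrow> real) set" where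
  "test_functions S =
     {u. (\<forall>k. C_k k u) \<and> compact (closure {x. u x \<noteq> 0}) \<and> closure {x. u x \<noteq> 0} \<subseteq> S}"

text \<open>
  For a test function \<open>u\<close> on the strip all three integrands are bounded with compact support, so the
  Bochner integrals never take their default value for non-integrable functions. On the strip
  \<open>0 < d \<le> R\<close>, so \<open>powr\<close> and \<open>ln\<close> are only evaluated at positive arguments.
\<close>

definition hardy_strip_ineq ::
  "real \<Rightarrow> real \<Rightarrow> real \<Rightarrow> real \<Rightarrow> ((real ^ 'm) \<times> real \<Rightarrow> real) \<Rightarrow> bool" where
  "hardy_strip_ineq R s \<gamma> C u \<longleftrightarrow>
     (let S = strip R; d = bdist S in
       (LINT x:S|lborel. norm (grad u x) / d x powr (s - 1)) \<ge>
         (s - 1) * (LINT x:S|lborel. \<bar>u x\<bar> / d x powr s) +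
         C / R powr (s - 1) * (LINT x:S|lborel. \<bar>u x\<bar> / d x * X (d x / R) powr \<gamma>))"

end

theory Submission
  imports Defs
begin

text \<open>
  Put \<open>\<Phi>(t) = t\<^sup>1\<^sup>-\<^sup>s - R\<^sup>1\<^sup>-\<^sup>s X\<^sup>\<gamma>\<^sup>-\<^sup>1(t/R)\<close>. Then \<open>\<Phi>(R) = 0\<close>, \<open>\<Phi>(t) \<le> t\<^sup>1\<^sup>-\<^sup>s\<close>, and \<open>-\<Phi>'\<close> is exactly
  the weight of \<open>|u|\<close> on the right-hand side with \<open>C = \<gamma> - 1\<close>. On each line in direction \<open>x\<^sub>n\<close>,
  integrating \<open>|u(t)| \<le> \<integral>\<^sub>0\<^sup>t |\<partial>\<^sub>n u|\<close> against \<open>-\<Phi>'\<close> over \<open>(0, R)\<close> and exchanging the integrals gives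
  the inequality on this half of the line; the other half follows by reflection.

  For \<open>\<gamma> = 1\<close>, test with \<open>u = \<eta>(x'/L) f(x\<^sub>n)\<close>, where \<open>f \<le> 1\<close> increases up to \<open>R\<close> and decreases
  afterwards. As \<open>f\<close> is monotone on both halves, \<open>\<integral> |f'| d\<^sup>1\<^sup>-\<^sup>s - (s - 1) \<integral> f d\<^sup>-\<^sup>s\<close> equals
  \<open>2 f(R) R\<^sup>1\<^sup>-\<^sup>s\<close>, whereas \<open>\<integral> f X(d/R) / d\<close> is unbounded, since \<open>X(t/R)/t\<close> has the primitive
  \<open>ln X(t/R)\<close>. The derivatives of \<open>\<eta>\<close> are negligible as \<open>L\<close> tends to infinity.
\<close>

section \<open>The one-dimensional inequality\<close>

lemma X_bounds:
  assumes "0 < t" "t \<le> 1"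
  shows "0 < X t" "X t \<le> 1"
proof -
  have "ln t \<le> 0" using assms by simp
  then show "0 < X t" "X t \<le> 1" by (auto simp: X_def intro!: inverse_le_1_iff[THEN iffD2])
qed

text \<open>The scale \<open>R\<close> cancels. Since differentiation turns \<open>X\<close> into
  \<open>X\<^sup>2 / t\<close>, powers of \<open>X\<close> divided by \<open>t\<close> have explicit
  primitives.\<close>

lemma DERIV_X_scaled:
  assumes "0 < t" "t \<le> R"
  shows "((\<lambda>t. X (t / R)) has_real_derivative (X (t / R))\<^sup>2 / t) (at t)"
proof -
  have "R > 0" "ln (t / R) \<le> 0" using assms by auto
  then have "1 - ln (t / R) \<noteq> 0" by linarith
  with assms \<open>R > 0\<close> show ?thesis
    unfolding X_def
    by (auto intro!: derivative_eq_intros simp: power2_eq_square field_simps)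
qed

definition hardy_weight :: "real \<Rightarrow> real \<Rightarrow> real \<Rightarrow> real \<Rightarrow> real" where
  "hardy_weight R s \<gamma> t =
     (s - 1) / t powr s + (\<gamma> - 1) / R powr (s - 1) * (X (t / R) powr \<gamma> / t)"

text \<open>This is \<Phi> of the overview, with the powers of \<open>t\<close> and \<open>R\<close>
  in denominators to match the shape of \<open>hardy_strip_ineq\<close>.\<close>

definition hardy_potential :: "real \<Rightarrow> real \<Rightarrow> real \<Rightarrow> real \<Rightarrow> real" where
  "hardy_potential R s \<gamma> t = 1 / t powr (s - 1) - X (t / R) powr (\<gamma> - 1) / R powr (s - 1)"

lemma DERIV_inverse_powr:
  fixes t :: real
  assumes "0 < t"
  shows "((\<lambda>t. 1 / t powr (s - 1)) has_real_derivative - ((s - 1) / t powr s)) (at t)"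
proof -
  have "((\<lambda>t. t powr (1 - s)) has_real_derivative (1 - s) * t powr (1 - s - 1)) (at t)"
    using assms by (rule has_real_derivative_powr)
  moreover have "t powr (1 - s - 1) = 1 / t powr s"
    using assms by (simp add: powr_minus_divide)
  moreover have "(\<lambda>t::real. t powr (1 - s)) = (\<lambda>t. 1 / t powr (s - 1))"
    by (metis minus_diff_eq powr_minus_divide)
  ultimately show ?thesis by (simp add: minus_divide_left)
qed

text \<open>The chain rule lowers the exponent of \<open>X\<close> to \<open>\<gamma> - 2\<close>,
  and the factor \<open>X\<^sup>2 / t\<close> raises it to \<open>\<gamma>\<close>; the factor
  \<open>\<gamma> - 1\<close> that appears is the constant of the theorem.\<close>

lemma DERIV_hardy_potential:
  assumes "0 < t" "t \<le> R"
  shows "(hardy_potential R s \<gamma> has_real_derivative - hardy_weight R s \<gamma> t) (at t)"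
proof -
  have x: "0 < X (t / R)" using assms by (intro X_bounds) auto
  have "((\<lambda>t. X (t / R) powr (\<gamma> - 1)) has_real_derivative
      (\<gamma> - 1) * X (t / R) powr (\<gamma> - 1 - 1) * ((X (t / R))\<^sup>2 / t)) (at t)"
    using DERIV_chain2[OF has_real_derivative_powr DERIV_X_scaled] x assms by blast
  moreover have "X (t / R) powr (\<gamma> - 1 - 1) * (X (t / R))\<^sup>2 = X (t / R) powr \<gamma>"
    using x by (simp flip: powr_numeral powr_add)
  ultimately have "((\<lambda>t. X (t / R) powr (\<gamma> - 1)) has_real_derivative
      (\<gamma> - 1) * (X (t / R) powr \<gamma> / t)) (at t)"
    by (simp add: mult.assoc)
  from DERIV_diff[OF DERIV_inverse_powr[OF assms(1)] DERIV_cdivide[OF this]]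
  show ?thesis
    unfolding hardy_potential_def hardy_weight_def by (rule DERIV_cong) simp
qed

lemma hardy_weight_nonneg:
  assumes "0 < t" "t \<le> R" "1 \<le> s" "1 \<le> \<gamma>"
  shows "0 \<le> hardy_weight R s \<gamma> t"
  unfolding hardy_weight_def using assms by auto

lemma hardy_potential_le:
  "hardy_potential R s \<gamma> t \<le> 1 / t powr (s - 1)"
  by (simp add: hardy_potential_def)

lemma borel_measurable_hardy_weight [measurable]:
  "hardy_weight R s \<gamma> \<in> borel_measurable borel"
  unfolding hardy_weight_def X_def by measurable

section \<open>Integration along a line\<close>

text \<open>The fundamental theorem of calculus, put in terms of the nonnegative integral so that
  the later exchange of integrals needs measurability only.\<close>

lemma abs_le_nn_integral_deriv:
  fixes f f' :: "real \<Rightarrow> real"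
  assumes f: "\<And>t. (f has_real_derivative f' t) (at t)"
    and f': "continuous_on UNIV f'" and "a \<le> b" and "f a = 0"
  shows "ennreal \<bar>f b\<bar> \<le> (\<integral>\<^sup>+t\<in>{a..b}. ennreal \<bar>f' t\<bar> \<partial>lborel)"
proof -
  have c: "continuous_on {a..b} f'" by (rule continuous_on_subset[OF f']) simp
  have "(f' has_integral f b - f a) {a..b}"
    using \<open>a \<le> b\<close> f
    by (intro fundamental_theorem_of_calculus) (auto intro: has_field_derivative_at_within
      simp flip: has_real_derivative_iff_has_vector_derivative)
  then have "f b = integral {a..b} f'" using \<open>f a = 0\<close> by (simp add: integral_unique)
  then have "\<bar>f b\<bar> \<le> integral {a..b} (\<lambda>t. \<bar>f' t\<bar>)"
    using integral_norm_bound_integral[of f' "{a..b}" "\<lambda>t. \<bar>f' t\<bar>"] c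
    by (auto intro!: integrable_continuous_real continuous_intros)
  moreover have "(\<integral>\<^sup>+t\<in>{a..b}. ennreal \<bar>f' t\<bar> \<partial>lborel) = ennreal (integral {a..b} (\<lambda>t. \<bar>f' t\<bar>))"
    using c by (intro nn_integral_has_integral_lebesgue' integrable_integral)
      (auto intro!: integrable_continuous_real continuous_intros)
  ultimately show ?thesis by (simp add: ennreal_leI)
qed

text \<open>No boundary term remains at \<open>R\<close>: since \<open>X 1 = 1\<close>, both parts
  of the potential agree there.\<close>

lemma nn_integral_hardy_weight:
  assumes "0 < r" "r \<le> R" "1 \<le> s" "1 < \<gamma>"
  shows "(\<integral>\<^sup>+t\<in>{r..R}. ennreal (hardy_weight R s \<gamma> t) \<partial>lborel) = ennreal (hardy_potential R s \<gamma> r)"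
proof -
  have "(hardy_weight R s \<gamma> has_integral
      (- hardy_potential R s \<gamma> R) - (- hardy_potential R s \<gamma> r)) {r..R}"
  proof (rule fundamental_theorem_of_calculus[where f = "\<lambda>t. - hardy_potential R s \<gamma> t"])
    fix t assume "t \<in> {r..R}"
    then have "((\<lambda>t. - hardy_potential R s \<gamma> t) has_real_derivative hardy_weight R s \<gamma> t) (at t within {r..R})"
      using DERIV_minus[OF DERIV_hardy_potential, of t R s \<gamma>] assms
      by (auto intro: has_field_derivative_at_within)
    then show "((\<lambda>t. - hardy_potential R s \<gamma> t) has_vector_derivative hardy_weight R s \<gamma> t) (at t within {r..R})"
      by (simp add: has_real_derivative_iff_has_vector_derivative)
  qed (use assms in simp)
  moreover have "hardy_potential R s \<gamma> R = 0"
    using assms by (simp add: hardy_potential_def X_def)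
  ultimately show ?thesis
    using assms
    by (intro nn_integral_has_integral_lebesgue') (simp_all add: hardy_weight_nonneg)
qed

lemma hardy_half_interval:
  fixes f f' :: "real \<Rightarrow> real"
  assumes f: "\<And>t. (f has_real_derivative f' t) (at t)"
    and f': "continuous_on UNIV f'" and "f 0 = 0" and "1 \<le> s" "1 < \<gamma>"
  shows "(\<integral>\<^sup>+t\<in>{0<..<R}. ennreal (\<bar>f t\<bar> * hardy_weight R s \<gamma> t) \<partial>lborel)
    \<le> (\<integral>\<^sup>+t\<in>{0<..<R}. ennreal (\<bar>f' t\<bar> / t powr (s - 1)) \<partial>lborel)"
proof -
  have [measurable]: "f' \<in> borel_measurable borel"
    using f' by (rule borel_measurable_continuous_onI)
  \<comment> \<open>The kernel lives on the triangle \<open>0 \<le> r \<le> t < R\<close>: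
    integrated in \<open>r\<close> it dominates the left-hand integrand at \<open>t\<close>,
    integrated in \<open>t\<close> it is controlled by the potential at \<open>r\<close>.\<close>
  define k where "k r t = ennreal \<bar>f' r\<bar> * ennreal (hardy_weight R s \<gamma> t) *
      (if 0 \<le> r \<and> r \<le> t \<and> 0 < t \<and> t < R then 1 else 0)" for r t
  have [measurable]: "(\<lambda>(r, t). k r t) \<in> borel_measurable (lborel \<Otimes>\<^sub>M lborel)"
    unfolding k_def by measurable
  have "(\<integral>\<^sup>+t\<in>{0<..<R}. ennreal (\<bar>f t\<bar> * hardy_weight R s \<gamma> t) \<partial>lborel)
      \<le> (\<integral>\<^sup>+t. \<integral>\<^sup>+r. k r t \<partial>lborel \<partial>lborel)"
  proof (intro nn_integral_mono)
    fix t :: real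
    show "ennreal (\<bar>f t\<bar> * hardy_weight R s \<gamma> t) * indicator {0<..<R} t \<le> (\<integral>\<^sup>+r. k r t \<partial>lborel)"
    proof (cases "0 < t \<and> t < R")
      case True
      have "ennreal (\<bar>f t\<bar> * hardy_weight R s \<gamma> t)
          = ennreal \<bar>f t\<bar> * ennreal (hardy_weight R s \<gamma> t)"
        by (simp add: ennreal_mult')
      also have "\<dots> \<le> (\<integral>\<^sup>+r\<in>{0..t}. ennreal \<bar>f' r\<bar> \<partial>lborel) * ennreal (hardy_weight R s \<gamma> t)"
        using True \<open>f 0 = 0\<close>
        by (intro mult_right_mono abs_le_nn_integral_deriv[OF f f']) auto
      also have "\<dots> = (\<integral>\<^sup>+r. k r t \<partial>lborel)"
        using True by (subst nn_integral_multc[symmetric])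
          (auto simp: k_def indicator_def intro!: nn_integral_cong)
      finally show ?thesis using True by simp
    qed simp
  qed
  also have "\<dots> = (\<integral>\<^sup>+r. \<integral>\<^sup>+t. k r t \<partial>lborel \<partial>lborel)"
    by (rule lborel_pair.Fubini') measurable
  also have "\<dots> \<le> (\<integral>\<^sup>+t\<in>{0<..<R}. ennreal (\<bar>f' t\<bar> / t powr (s - 1)) \<partial>lborel)"
  proof (rule nn_integral_mono_AE)
    show "AE r in lborel. (\<integral>\<^sup>+t. k r t \<partial>lborel)
      \<le> ennreal (\<bar>f' r\<bar> / r powr (s - 1)) * indicator {0<..<R} r"
      \<comment> \<open>At \<open>r = 0\<close> the right-hand side is zero while the inner integral
        need not vanish; this single point is discarded.\<close>
      using AE_lborel_singleton[of 0]
    proof eventually_elim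
      fix r :: real assume "r \<noteq> 0"
      show "(\<integral>\<^sup>+t. k r t \<partial>lborel) \<le> ennreal (\<bar>f' r\<bar> / r powr (s - 1)) * indicator {0<..<R} r"
      proof (cases "0 < r \<and> r < R")
        case True
        have "(\<integral>\<^sup>+t. k r t \<partial>lborel)
            \<le> (\<integral>\<^sup>+t. ennreal \<bar>f' r\<bar> * (ennreal (hardy_weight R s \<gamma> t) * indicator {r..R} t) \<partial>lborel)"
          by (intro nn_integral_mono) (auto simp: k_def)
        also have "\<dots> = ennreal \<bar>f' r\<bar> * ennreal (hardy_potential R s \<gamma> r)"
          using True assms by (subst nn_integral_cmult) (auto simp: nn_integral_hardy_weight)
        also have "\<dots> \<le> ennreal \<bar>f' r\<bar> * ennreal (1 / r powr (s - 1))"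
          by (intro mult_left_mono ennreal_leI hardy_potential_le) simp
        also have "\<dots> = ennreal (\<bar>f' r\<bar> / r powr (s - 1))"
          by (simp flip: ennreal_mult')
        finally show ?thesis using True by simp
      next
        case False
        then have "k r t = 0" for t using \<open>r \<noteq> 0\<close> by (auto simp: k_def)
        then show ?thesis by simp
      qed
    qed
  qed
  finally show ?thesis .
qed

text \<open>The reflection \<open>t \<mapsto> 2 * R - t\<close> preserves \<open>d\<close> and
  exchanges the halves, so the half-interval bound applies to \<open>f\<close> and to its
  reflection, both of which vanish at \<open>0\<close>.\<close>

lemma hardy_full_interval:
  fixes f f' :: "real \<Rightarrow> real"
  assumes f: "\<And>t. (f has_real_derivative f' t) (at t)"
    and f': "continuous_on UNIV f'" and "f 0 = 0" "f (2 * R) = 0" and "1 \<le> s" "1 < \<gamma>"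
  defines "d \<equiv> \<lambda>t. min t (2 * R - t)"
  shows "(\<integral>\<^sup>+t\<in>{0<..<2*R}. ennreal (\<bar>f t\<bar> * hardy_weight R s \<gamma> (d t)) \<partial>lborel)
    \<le> (\<integral>\<^sup>+t\<in>{0<..<2*R}. ennreal (\<bar>f' t\<bar> / d t powr (s - 1)) \<partial>lborel)"
proof -
  have [measurable]: "f' \<in> borel_measurable borel" "f \<in> borel_measurable borel"
    using f' f by (auto intro!: borel_measurable_continuous_onI DERIV_continuous_on)
  \<comment> \<open>Position and distance are separate arguments of \<open>g\<close>: after
    reflection of the right half the distance is simply \<open>t\<close>, and only the position
    stays reflected. The midpoint is a null set.\<close>
  have split: "(\<integral>\<^sup>+t\<in>{0<..<2*R}. g t (d t) \<partial>lborel)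
      = (\<integral>\<^sup>+t\<in>{0<..<R}. g t t \<partial>lborel) + (\<integral>\<^sup>+t\<in>{0<..<R}. g (2 * R - t) t \<partial>lborel)"
    if [measurable]: "(\<lambda>(t, r). g t r) \<in> borel_measurable (borel \<Otimes>\<^sub>M borel)"
    for g :: "real \<Rightarrow> real \<Rightarrow> ennreal"
  proof -
    have "(\<integral>\<^sup>+t\<in>{0<..<2*R}. g t (d t) \<partial>lborel)
        = (\<integral>\<^sup>+t. g t t * indicator {0<..<R} t + g t (2 * R - t) * indicator {R<..<2*R} t \<partial>lborel)"
      using AE_lborel_singleton[of R]
      by (intro nn_integral_cong_AE, eventually_elim) (auto simp: d_def indicator_def min_def)
    also have "\<dots> = (\<integral>\<^sup>+t\<in>{0<..<R}. g t t \<partial>lborel)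
        + (\<integral>\<^sup>+t. g t (2 * R - t) * indicator {R<..<2*R} t \<partial>lborel)"
      by (rule nn_integral_add) measurable
    also have "(\<integral>\<^sup>+t. g t (2 * R - t) * indicator {R<..<2*R} t \<partial>lborel)
        = (\<integral>\<^sup>+t\<in>{0<..<R}. g (2 * R - t) t \<partial>lborel)"
      by (subst nn_integral_real_affine[where c="-1" and t="2 * R"])
        (auto intro!: nn_integral_cong simp: indicator_def)
    finally show ?thesis .
  qed
  have "((\<lambda>t. f (2 * R - t)) has_real_derivative - f' (2 * R - t)) (at t)" for t
    by (rule DERIV_cong[OF DERIV_chain2[OF f, of "\<lambda>t. 2 * R - t" "-1"]])
      (auto intro!: derivative_eq_intros)
  moreover have "continuous_on UNIV (\<lambda>t. - f' (2 * R - t))"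
    by (intro continuous_intros continuous_on_compose2[OF f']) auto
  ultimately have "(\<integral>\<^sup>+t\<in>{0<..<R}. ennreal (\<bar>f (2 * R - t)\<bar> * hardy_weight R s \<gamma> t) \<partial>lborel)
      \<le> (\<integral>\<^sup>+t\<in>{0<..<R}. ennreal (\<bar>f' (2 * R - t)\<bar> / t powr (s - 1)) \<partial>lborel)"
    using hardy_half_interval[of "\<lambda>t. f (2 * R - t)" "\<lambda>t. - f' (2 * R - t)" s \<gamma> R] assms
    by simp
  with hardy_half_interval[OF f f' \<open>f 0 = 0\<close>, of s \<gamma> R] assms show ?thesis
    by (subst (1 2) split) (auto intro!: add_mono)
qed

section \<open>The inequality on the strip\<close>

text \<open>The points straight below and above on the boundary hyperplanes give the upper bound;
  projection to the last coordinate does not increase distances, which gives the lower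
  bound.\<close>

lemma bdist_strip:
  fixes x' :: "real ^ 'm"
  assumes "0 < t" "t < 2 * R"
  shows "bdist (strip R) (x', t) = min t (2 * R - t)"
proof (rule antisym)
  have out: "(x', 0) \<in> - strip R" "(x', 2 * R) \<in> - strip R"
    by (auto simp: strip_def)
  then have ne: "- strip R \<noteq> ({} :: ((real ^ 'm) \<times> real) set)" by blast
  show "bdist (strip R) (x', t) \<le> min t (2 * R - t)"
    using infdist_le[OF out(1), of "(x', t)"] infdist_le[OF out(2), of "(x', t)"] assms
    by (simp add: bdist_def dist_Pair_Pair dist_real_def)
  show "min t (2 * R - t) \<le> bdist (strip R) (x', t)"
    unfolding bdist_def infdist_notempty[OF ne]
  proof (rule cINF_greatest[OF ne])
    fix y :: "(real ^ 'm) \<times> real" assume "y \<in> - strip R"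
    then have "min t (2 * R - t) \<le> dist t (snd y)"
      by (cases y) (auto simp: strip_def dist_real_def)
    also have "\<dots> \<le> dist (x', t) y"
      using dist_snd_le[of "(x', t)" y] by simp
    finally show "min t (2 * R - t) \<le> dist (x', t) y" .
  qed
qed

lemma bdist_strip_bounds:
  assumes "x \<in> strip R"
  shows "0 < bdist (strip R) x" "bdist (strip R) x \<le> R"
proof -
  obtain x' t where "x = (x', t)" "0 < t" "t < 2 * R"
    using assms by (cases x) (auto simp: strip_def)
  then show "0 < bdist (strip R) x" "bdist (strip R) x \<le> R"
    by (auto simp: bdist_strip)
qed

lemma grad_eqI:
  assumes "(u has_derivative (\<lambda>v. g \<bullet> v)) (at x)"
  shows "grad u x = g"
proof -
  have "frechet_derivative u (at x) = (\<lambda>v. g \<bullet> v)"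
    using frechet_derivative_at[OF assms] by simp
  then show ?thesis by (simp add: grad_def euclidean_representation)
qed

lemma inner_grad:
  assumes "u differentiable at x"
  shows "grad u x \<bullet> v = frechet_derivative u (at x) v"
proof -
  interpret linear "frechet_derivative u (at x)"
    using assms by (rule linear_frechet_derivative)
  have "grad u x \<bullet> v = (\<Sum>b\<in>Basis. (v \<bullet> b) * frechet_derivative u (at x) b)"
    by (simp add: grad_def inner_sum_left inner_commute[of v] mult.commute)
  also have "\<dots> = frechet_derivative u (at x) (\<Sum>b\<in>Basis. (v \<bullet> b) *\<^sub>R b)"
    by (simp add: sum scale)
  finally show ?thesis by (simp add: euclidean_representation)
qed

lemma test_functionsD:
  assumes "u \<in> test_functions S"
  shows test_function_has_derivative: "(u has_derivative (\<lambda>v. grad u x \<bullet> v)) (at x)"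
    and test_function_continuous: "continuous_on A u"
    and test_function_grad_continuous: "continuous_on A (grad u)"
    and test_function_compact: "compact (closure {x. u x \<noteq> 0})"
    and test_function_support: "closure {x. u x \<noteq> 0} \<subseteq> S"
proof -
  have *: "C_k (Suc 0) u" "compact (closure {x. u x \<noteq> 0})" "closure {x. u x \<noteq> 0} \<subseteq> S"
    using assms unfolding test_functions_def by blast+
  then show "compact (closure {x. u x \<noteq> 0})" "closure {x. u x \<noteq> 0} \<subseteq> S" by auto
  have d: "u differentiable at x" for x
    using *(1) by (simp add: differentiable_on_def)
  show "(u has_derivative (\<lambda>v. grad u x \<bullet> v)) (at x)"
    using d[of x] by (simp add: inner_grad frechet_derivative_works[symmetric])
  have "continuous_on UNIV u"
    using *(1) by (simp add: differentiable_imp_continuous_on)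
  then show "continuous_on A u" by (rule continuous_on_subset) simp
  have "continuous_on UNIV (grad u)"
    using *(1) unfolding grad_def by (auto intro!: continuous_intros)
  then show "continuous_on A (grad u)" by (rule continuous_on_subset) simp
qed

text \<open>The complement of the support is open, so \<open>u\<close> is zero in a whole
  neighbourhood of \<open>x\<close> and its gradient vanishes too.\<close>

lemma test_function_vanishes:
  assumes "u \<in> test_functions S" "x \<notin> closure {x. u x \<noteq> 0}"
  shows "u x = 0" "grad u x = 0"
proof -
  have z: "u y = 0" if "y \<in> - closure {x. u x \<noteq> 0}" for y
    using that closure_subset[of "{x. u x \<noteq> 0}"] by blast
  then show "u x = 0" using assms(2) by blast
  have "((\<lambda>_. 0 :: real) has_derivative (\<lambda>v. 0)) (at x)"
    by (rule has_derivative_const)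
  then have "(u has_derivative (\<lambda>v. 0)) (at x)"
  proof (rule has_derivative_transform_within_open)
    show "0 = u y" if "y \<in> - closure {x. u x \<noteq> 0}" for y
      using z[OF that] by (rule sym)
  qed (use assms(2) in blast)+
  then show "grad u x = 0" by (intro grad_eqI) simp
qed

text \<open>Weights that blow up at the boundary of \<open>S\<close> are harmless, since continuity
  is required only on the compact set \<open>K\<close>.\<close>

lemma set_integrable_vanishing:
  fixes F :: "'a::euclidean_space \<Rightarrow> real"
  assumes "compact K" "K \<subseteq> S" "continuous_on K F" "\<And>x. x \<in> S - K \<Longrightarrow> F x = 0"
  shows "set_integrable lborel S F"
proof -
  have "(\<lambda>x. indicator S x *\<^sub>R F x) = (\<lambda>x. indicator K x *\<^sub>R F x)"
    using assms(2,4) by (auto simp: indicator_def fun_eq_iff)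
  then show ?thesis
    using borel_integrable_compact[OF assms(1,3)] by (simp add: set_integrable_def)
qed

lemma continuous_on_bdist [continuous_intros]: "continuous_on A (bdist S)"
  unfolding bdist_def[abs_def] by (intro continuous_intros)

text \<open>The support is compact inside the open strip, so \<open>d\<close> is positive on it and
  the singular weights are continuous there; \<open>d x \<le> R\<close> keeps
  \<open>1 - ln (d x / R)\<close> away from zero.\<close>

lemma hardy_strip_integrable:
  fixes u :: "(real ^ 'm) \<times> real \<Rightarrow> real"
  assumes u: "u \<in> test_functions (strip R)"
  defines "d \<equiv> bdist (strip R :: ((real ^ 'm) \<times> real) set)"
  shows "set_integrable lborel (strip R) (\<lambda>x. norm (grad u x) / d x powr (s - 1))"
    and "set_integrable lborel (strip R) (\<lambda>x. \<bar>u x\<bar> / d x powr s)"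
    and "set_integrable lborel (strip R) (\<lambda>x. \<bar>u x\<bar> / d x * X (d x / R) powr \<gamma>)"
proof -
  define K where "K = closure {x. u x \<noteq> 0}"
  note c = test_function_continuous[OF u] test_function_grad_continuous[OF u]
  note supp = test_function_compact[OF u, folded K_def] test_function_support[OF u, folded K_def]
  note van = test_function_vanishes[OF u, folded K_def]
  have d: "0 < d x" "d x \<le> R" "0 < R" if "x \<in> K" for x
    using bdist_strip_bounds[of x R] supp(2) that by (auto simp: d_def)
  have cd: "continuous_on A d" for A
    unfolding d_def by (intro continuous_intros)
  have d0: "d x \<noteq> 0" "1 - ln (d x / R) \<noteq> 0" "X (d x / R) \<noteq> 0" "d x / R \<noteq> 0"
    if "x \<in> K" for x
  proof -
    have "0 < d x / R" "d x / R \<le> 1" using d[OF that] by auto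
    moreover from this have "0 < X (d x / R)" "ln (d x / R) \<le> 0"
      by (simp_all add: X_bounds)
    ultimately show "d x \<noteq> 0" "1 - ln (d x / R) \<noteq> 0" "X (d x / R) \<noteq> 0" "d x / R \<noteq> 0"
      by (force, linarith, linarith, linarith)
  qed
  have "continuous_on (K) (\<lambda>x. norm (grad u x) / d x powr (s - 1))"
    "continuous_on (K) (\<lambda>x. \<bar>u x\<bar> / d x powr s)"
    by (intro continuous_intros c cd; use d0 in simp)+
  then show "set_integrable lborel (strip R) (\<lambda>x. norm (grad u x) / d x powr (s - 1))"
    "set_integrable lborel (strip R) (\<lambda>x. \<bar>u x\<bar> / d x powr s)"
    by (auto intro!: set_integrable_vanishing[OF supp] simp: van)
  have "continuous_on (K) (\<lambda>x. X (d x / R))"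
    unfolding X_def by (intro continuous_intros cd; use d0 d(3) in auto)
  then have "continuous_on (K) (\<lambda>x. \<bar>u x\<bar> / d x * X (d x / R) powr \<gamma>)"
    by (intro continuous_intros c cd; use d0 in simp)
  then show "set_integrable lborel (strip R) (\<lambda>x. \<bar>u x\<bar> / d x * X (d x / R) powr \<gamma>)"
    by (auto intro!: set_integrable_vanishing[OF supp] simp: van)
qed

section \<open>From lines to the strip\<close>

text \<open>Tonelli's theorem with the strip as a product; integrability supplies the measurability
  of the integrand.\<close>

lemma nn_integral_strip:
  fixes F :: "(real ^ 'm) \<times> real \<Rightarrow> real"
  assumes "set_integrable lborel (strip R) F"
  shows "(\<integral>\<^sup>+x. ennreal (indicator (strip R) x * F x) \<partial>lborel)
    = (\<integral>\<^sup>+x'. (\<integral>\<^sup>+t\<in>{0<..<2*R}. ennreal (F (x', t)) \<partial>lborel) \<partial>lborel)"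
proof -
  have [measurable]: "(\<lambda>x. indicator (strip R) x * F x) \<in> borel_measurable lborel"
    using assms by (auto simp: set_integrable_def dest: borel_measurable_integrable)
  have "(\<integral>\<^sup>+x. ennreal (indicator (strip R) x * F x) \<partial>lborel)
      = (\<integral>\<^sup>+x. ennreal (indicator (strip R) x * F x) \<partial>(lborel \<Otimes>\<^sub>M lborel))"
    by (simp add: lborel_prod)
  also have "\<dots> = (\<integral>\<^sup>+x'. \<integral>\<^sup>+t. ennreal (indicator (strip R) (x', t) * F (x', t)) \<partial>lborel \<partial>lborel)"
    by (subst lborel.nn_integral_fst[symmetric]) (simp_all add: lborel_prod)
  also have "\<dots> = (\<integral>\<^sup>+x'. (\<integral>\<^sup>+t\<in>{0<..<2*R}. ennreal (F (x', t)) \<partial>lborel) \<partial>lborel)"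
    by (intro nn_integral_cong) (simp add: indicator_def strip_def)
  finally show ?thesis .
qed

text \<open>On each line \<open>hardy_full_interval\<close> bounds the weighted integral by that of
  the last partial derivative, which the full gradient dominates; it remains to integrate over
  \<open>x'\<close>.\<close>

lemma hardy_strip:
  fixes u :: "(real ^ 'm) \<times> real \<Rightarrow> real"
  assumes "1 \<le> s" "1 < \<gamma>" and u: "u \<in> test_functions (strip R)"
  shows "hardy_strip_ineq R s \<gamma> (\<gamma> - 1) u"
proof -
  define S where "S = (strip R :: ((real ^ 'm) \<times> real) set)"
  define d where "d = bdist S"
  define G where "G x = \<bar>u x\<bar> * hardy_weight R s \<gamma> (d x)" for x
  define H where "H x = norm (grad u x) / d x powr (s - 1)" for x
  note int = hardy_strip_integrable[OF u, folded S_def, folded d_def]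
  have G: "G = (\<lambda>x. (s - 1) * (\<bar>u x\<bar> / d x powr s)
      + (\<gamma> - 1) / R powr (s - 1) * (\<bar>u x\<bar> / d x * X (d x / R) powr \<gamma>))"
    by (simp add: G_def hardy_weight_def fun_eq_iff algebra_simps)
  have iG: "set_integrable lborel S G"
    unfolding G by (intro set_integral_add set_integrable_mult_right int)
  have iH: "set_integrable lborel S H"
    unfolding H_def by (rule int)
  have d: "0 < d x" "d x \<le> R" if "x \<in> S" for x
    using bdist_strip_bounds[of x R] that by (simp_all add: d_def S_def)
  have G0: "0 \<le> indicator S x * G x" for x
    using hardy_weight_nonneg[OF d, of x s \<gamma>] assms by (auto simp: G_def indicator_def)
  have H0: "0 \<le> indicator S x * H x" for x by (simp add: H_def)
  have "(\<integral>\<^sup>+t\<in>{0<..<2*R}. ennreal (G (x', t)) \<partial>lborel)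
      \<le> (\<integral>\<^sup>+t\<in>{0<..<2*R}. ennreal (H (x', t)) \<partial>lborel)" for x'
  proof -
    \<comment> \<open>Pairing the gradient with \<open>(0, 1)\<close> yields the partial derivative
      in the last variable.\<close>
    let ?f = "\<lambda>t. u (x', t)" and ?f' = "\<lambda>t. grad u (x', t) \<bullet> (0, 1)"
    have f: "(?f has_real_derivative ?f' t) (at t)" for t
    proof -
      have "((\<lambda>t. (x', t)) has_derivative (\<lambda>h. (0, h))) (at t)"
        by (intro derivative_eq_intros) auto
      from has_derivative_compose[OF this test_function_has_derivative[OF u]]
      show ?thesis
        by (simp add: has_field_derivative_def inner_prod_def)
    qed
    have f': "continuous_on UNIV ?f'"
      by (intro continuous_intros continuous_on_compose2[OF test_function_grad_continuous[OF u, of UNIV]]) auto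
    have van: "u x = 0" if "x \<notin> S" for x
      using test_function_support[OF u] test_function_vanishes(1)[OF u, of x] that
      by (auto simp: S_def)
    have dt: "d (x', t) = min t (2 * R - t)" if "t \<in> {0<..<2*R}" for t
      using that by (simp add: d_def S_def bdist_strip)
    have "(\<integral>\<^sup>+t\<in>{0<..<2*R}. ennreal (G (x', t)) \<partial>lborel)
        = (\<integral>\<^sup>+t\<in>{0<..<2*R}. ennreal (\<bar>?f t\<bar> * hardy_weight R s \<gamma> (min t (2 * R - t))) \<partial>lborel)"
      by (intro nn_integral_cong) (auto simp: indicator_def G_def dt)
    also have "\<dots> \<le> (\<integral>\<^sup>+t\<in>{0<..<2*R}. ennreal (\<bar>?f' t\<bar> / min t (2 * R - t) powr (s - 1)) \<partial>lborel)"
      using assms by (intro hardy_full_interval[OF f f'] van) (auto simp: S_def strip_def)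
    also have "\<dots> \<le> (\<integral>\<^sup>+t\<in>{0<..<2*R}. ennreal (H (x', t)) \<partial>lborel)"
    proof (intro nn_integral_mono)
      fix t :: real
      have "\<bar>?f' t\<bar> \<le> norm (grad u (x', t))"
        using Cauchy_Schwarz_ineq2[of "grad u (x', t)" "(0, 1)"] by (simp add: norm_Pair)
      then show "ennreal (\<bar>?f' t\<bar> / min t (2 * R - t) powr (s - 1)) * indicator {0<..<2*R} t
          \<le> ennreal (H (x', t)) * indicator {0<..<2*R} t"
        by (auto simp: indicator_def H_def dt intro!: ennreal_leI divide_right_mono)
    qed
    finally show ?thesis .
  qed
  then have "(\<integral>\<^sup>+x. ennreal (indicator S x * G x) \<partial>lborel) \<le> (\<integral>\<^sup>+x. ennreal (indicator S x * H x) \<partial>lborel)"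
    using iG iH unfolding S_def by (simp add: nn_integral_strip nn_integral_mono)
  \<comment> \<open>Both integrands are integrable and nonnegative on \<open>S\<close>, so the
    inequality of nonnegative integrals carries over to Bochner integrals.\<close>
  then have "(LINT x:S|lborel. G x) \<le> (LINT x:S|lborel. H x)"
    using iG iH G0 H0
    by (simp add: set_lebesgue_integral_def set_integrable_def nn_integral_eq_integral
        ennreal_le_iff integral_nonneg_AE)
  also have "(LINT x:S|lborel. G x) = (s - 1) * (LINT x:S|lborel. \<bar>u x\<bar> / d x powr s) +
      (\<gamma> - 1) / R powr (s - 1) * (LINT x:S|lborel. \<bar>u x\<bar> / d x * X (d x / R) powr \<gamma>)"
    unfolding G by (subst set_integral_add(2))
      (simp_all add: int del: times_divide_eq_left times_divide_eq_right)
  finally show ?thesis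
    unfolding hardy_strip_ineq_def Let_def H_def[abs_def] d_def S_def .
qed

section \<open>Smooth cutoff functions\<close>

text \<open>
  The functions \<open>p(1/t) exp(-1/t)\<close>, extended by zero to \<open>t \<le> 0\<close>, form a class closed under
  differentiation; hence they are smooth.
\<close>

definition flat :: "real poly \<Rightarrow> real \<Rightarrow> real" where
  "flat p t = (if t > 0 then poly p (1 / t) * exp (- (1 / t)) else 0)"

text \<open>With \<open>y\<close> the inverse of \<open>h\<close>, this settles the right difference
  quotient of \<open>flat p\<close> at zero.\<close>

lemma tendsto_poly_exp_neg:
  fixes p :: "real poly"
  shows "((\<lambda>y. poly p y * exp (- y)) \<longlongrightarrow> 0) at_top"
proof -
  have "((\<lambda>y. \<Sum>i\<le>degree p. coeff p i * (y ^ i / exp y)) \<longlongrightarrow> (\<Sum>i\<le>degree p. coeff p i * 0)) at_top"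
    by (intro tendsto_sum tendsto_mult tendsto_const tendsto_power_div_exp_0)
  then show ?thesis
    by (simp add: poly_altdef sum_divide_distrib exp_minus field_simps)
qed

text \<open>With \<open>y = 1 / t\<close>, whose derivative is \<open>- y\<^sup>2\<close>, the
  function \<open>p(y) exp(-y)\<close> has derivative
  \<open>y\<^sup>2 (p(y) - p'(y)) exp(-y)\<close>; the polynomial \<open>[:0, 0, 1:]\<close> is
  \<open>y\<^sup>2\<close>.\<close>

lemma DERIV_flat:
  "(flat p has_real_derivative flat ([:0, 0, 1:] * (p - pderiv p)) t) (at t)"
proof -
  consider "t < 0" | "t = 0" | "t > 0" by linarith
  then show ?thesis
  proof cases
    case 1
    have "((\<lambda>_. 0) has_real_derivative 0) (at t)" by simp
    then have "(flat p has_real_derivative 0) (at t)"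
      by (rule has_field_derivative_transform_within_open[where S = "{..<0}"])
        (use 1 in \<open>auto simp: flat_def\<close>)
    then show ?thesis using 1 by (simp add: flat_def)
  next
    case 2
    have "((\<lambda>h. (flat p (0 + h) - flat p 0) / h) \<longlongrightarrow> 0) (at 0)"
    proof (rule filterlim_split_at)
      show "((\<lambda>h. (flat p (0 + h) - flat p 0) / h) \<longlongrightarrow> 0) (at_left 0)"
        by (rule tendsto_eventually) (auto simp: flat_def eventually_at_filter)
      \<comment> \<open>Dividing by \<open>h\<close> multiplies the polynomial by its variable,
        hence \<open>pCons 0 p\<close>.\<close>
      have "((\<lambda>h. poly (pCons 0 p) (inverse h) * exp (- inverse h)) \<longlongrightarrow> 0) (at_right 0)"
        by (rule filterlim_compose[OF tendsto_poly_exp_neg filterlim_inverse_at_top_right])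
      moreover have "eventually (\<lambda>h. poly (pCons 0 p) (inverse h) * exp (- inverse h)
          = (flat p (0 + h) - flat p 0) / h) (at_right 0)"
        by (auto simp: flat_def eventually_at_filter field_simps)
      ultimately show "((\<lambda>h. (flat p (0 + h) - flat p 0) / h) \<longlongrightarrow> 0) (at_right 0)"
        by (rule Lim_transform_eventually)
    qed
    then show ?thesis using 2 by (simp add: DERIV_def flat_def)
  next
    case 3
    have "((\<lambda>t. poly p (1 / t) * exp (- (1 / t))) has_real_derivative
        flat ([:0, 0, 1:] * (p - pderiv p)) t) (at t)"
      using 3 by (auto intro!: derivative_eq_intros poly_DERIV[THEN DERIV_chain2]
        simp: flat_def field_simps power2_eq_square)
    then show ?thesis
      by (rule has_field_derivative_transform_within_open[where S = "{0<..}"])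
        (use 3 in \<open>auto simp: flat_def\<close>)
  qed
qed

section \<open>Closure properties of the classes \<open>C_k\<close>\<close>

text \<open>Derivatives are unique, so \<open>frechet_derivative\<close> in \<open>C_k\<close> may
  be replaced by any derivative given in closed form.\<close>

lemma C_k_SucI:
  assumes u: "\<And>x. (u has_derivative u' x) (at x)"
    and "\<And>b. b \<in> Basis \<Longrightarrow> C_k k (\<lambda>x. u' x b)"
  shows "C_k (Suc k) u"
proof -
  have "frechet_derivative u (at x) = u' x" for x
    using frechet_derivative_at[OF u] by simp
  then show ?thesis
    using assms by (auto simp: differentiable_on_def intro: differentiableI)
qed

lemma C_k_Suc_has_derivative:
  assumes "C_k (Suc k) u"
  shows "(u has_derivative frechet_derivative u (at x)) (at x)"
  using assms by (simp add: differentiable_on_def flip: frechet_derivative_works)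

lemma C_k_Suc_imp: "C_k (Suc k) u \<Longrightarrow> C_k k u"
proof (induction k arbitrary: u)
  case 0
  then show ?case by (simp add: differentiable_imp_continuous_on)
next
  case (Suc k)
  then show ?case using C_k.simps(2) by blast
qed

lemma C_k_const: "C_k k (\<lambda>x. c)"
  by (induction k arbitrary: c) (auto intro: C_k_SucI[OF has_derivative_const])

lemma C_k_add: "C_k k u \<Longrightarrow> C_k k v \<Longrightarrow> C_k k (\<lambda>x. u x + v x)"
proof (induction k arbitrary: u v)
  case 0
  then show ?case by (simp add: continuous_on_add)
next
  case (Suc k)
  show ?case
    by (rule C_k_SucI[OF has_derivative_add[OF Suc.prems[THEN C_k_Suc_has_derivative]]])
      (use Suc in simp)
qed

text \<open>The product rule leaves one factor undifferentiated in each summand;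
  \<open>C_k_Suc_imp\<close> lowers its order so that the induction hypothesis applies.\<close>

lemma C_k_mult: "C_k k u \<Longrightarrow> C_k k v \<Longrightarrow> C_k k (\<lambda>x. u x * v x)"
proof (induction k arbitrary: u v)
  case 0
  then show ?case by (simp add: continuous_on_mult)
next
  case (Suc k)
  show ?case
    by (rule C_k_SucI[OF has_derivative_mult[OF Suc.prems[THEN C_k_Suc_has_derivative]]])
      (use Suc Suc.prems[THEN C_k_Suc_imp] in \<open>simp add: C_k_add\<close>)
qed

lemma C_k_linear:
  assumes "bounded_linear l"
  shows "C_k k l"
proof (cases k)
  case 0
  then show ?thesis using assms by (simp add: linear_continuous_on)
next
  case (Suc m)
  then show ?thesis
    using C_k_SucI[OF bounded_linear_imp_has_derivative[OF assms] C_k_const] by simp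
qed

text \<open>The square of the norm, unlike the norm, is smooth at the origin: its directional
  derivatives are linear.\<close>

lemma C_k_norm_fst_square:
  "C_k k (\<lambda>x :: 'a::euclidean_space \<times> 'b::euclidean_space. (norm (fst x))\<^sup>2)"
proof (cases k)
  case 0
  then show ?thesis by (auto intro!: continuous_intros)
next
  case (Suc m)
  have "((\<lambda>x :: 'a \<times> 'b. (norm (fst x))\<^sup>2) has_derivative (\<lambda>v. 2 * (fst x \<bullet> fst v))) (at x)" for x
    unfolding power2_norm_eq_inner
    by (auto intro!: derivative_eq_intros simp: inner_commute)
  moreover have "C_k m (\<lambda>x :: 'a \<times> 'b. 2 * (fst x \<bullet> fst b))" for b :: "'a \<times> 'b"
    by (intro C_k_mult C_k_const C_k_linear bounded_linear_compose[OF bounded_linear_inner_left]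
        bounded_linear_fst)
  ultimately show ?thesis unfolding Suc by (rule C_k_SucI)
qed

text \<open>The induction keeps \<open>p\<close> arbitrary, since each differentiation replaces it
  by another polynomial.\<close>

lemma C_k_flat:
  assumes "\<And>k. C_k k q"
  shows "C_k k (\<lambda>x. flat p (q x))"
proof (induction k arbitrary: p)
  case 0
  have "continuous_on UNIV (flat p)" by (rule DERIV_continuous_on[OF DERIV_flat])
  then show ?case
    using continuous_on_compose2[of UNIV "flat p" UNIV q] assms[of 0] by simp
next
  case (Suc k)
  have "((\<lambda>x. flat p (q x)) has_derivative
      (\<lambda>v. flat ([:0, 0, 1:] * (p - pderiv p)) (q x) * frechet_derivative q (at x) v)) (at x)" for x
    using has_derivative_compose[OF C_k_Suc_has_derivative[OF assms] DERIV_flat[unfolded has_field_derivative_def]] .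
  then show ?case
    by (rule C_k_SucI) (use assms[of "Suc k"] in \<open>simp add: C_k_mult Suc.IH\<close>)
qed

section \<open>Optimality of the logarithmic term\<close>

lemma flat_one: "flat 1 t = (if t > 0 then exp (- (1 / t)) else 0)"
  by (simp add: flat_def)

text \<open>By \<open>DERIV_flat\<close> with \<open>p = 1\<close>, this is the derivative of
  \<open>flat 1\<close>. The upper bound comes from \<open>y\<^sup>2 / 2 \<le> exp y\<close> at
  \<open>y = 1 / t\<close>.\<close>

lemma flat_deriv_bounds:
  "0 \<le> flat [:0, 0, 1:] t" "flat [:0, 0, 1:] t \<le> 2"
proof -
  show "0 \<le> flat [:0, 0, 1:] t" by (simp add: flat_def)
  have "y\<^sup>2 * exp (- y) \<le> 2" if "0 < y" for y :: real
  proof -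
    have "y\<^sup>2 \<le> 2 * exp y" using exp_lower_Taylor_quadratic[of y] that by simp
    then have "y\<^sup>2 * exp (- y) \<le> 2 * exp y * exp (- y)" by (intro mult_right_mono) auto
    then show ?thesis by (simp add: mult.assoc flip: exp_add)
  qed
  from this[of "1 / t"] show "flat [:0, 0, 1:] t \<le> 2"
    by (auto simp: flat_def power2_eq_square)
qed

lemma DERIV_flat_one: "(flat 1 has_real_derivative flat [:0, 0, 1:] t) (at t)"
  using DERIV_flat[of 1 t] by (simp add: one_pCons)

section \<open>One-dimensional integrals of a profile\<close>

text \<open>Monotonicity fixes the sign of \<open>f'\<close>, so the integrand is the derivative of
  \<open>f / d powr (s - 1)\<close> on the left half and of its negative on the right half. The end
  values vanish and the two values at \<open>R\<close> add up.\<close>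

lemma hardy_difference_has_integral:
  fixes f f' :: "real \<Rightarrow> real"
  assumes f: "\<And>t. (f has_real_derivative f' t) (at t)"
    and "0 < a" "a \<le> R" "f a = 0" "f (2 * R - a) = 0"
    and incr: "\<And>t. a \<le> t \<Longrightarrow> t \<le> R \<Longrightarrow> 0 \<le> f' t"
    and decr: "\<And>t. R \<le> t \<Longrightarrow> t \<le> 2 * R - a \<Longrightarrow> f' t \<le> 0"
  defines "d \<equiv> \<lambda>t. min t (2 * R - t)"
  shows "((\<lambda>t. \<bar>f' t\<bar> / d t powr (s - 1) - (s - 1) * (f t / d t powr s))
    has_integral 2 * (f R / R powr (s - 1))) {a..2 * R - a}"
proof -
  let ?g = "\<lambda>t. \<bar>f' t\<bar> / d t powr (s - 1) - (s - 1) * (f t / d t powr s)"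
  have "(?g has_integral f R * (1 / R powr (s - 1)) - f a * (1 / a powr (s - 1))) {a..R}"
  proof (rule fundamental_theorem_of_calculus[where f = "\<lambda>t. f t * (1 / t powr (s - 1))"])
    fix t assume t: "t \<in> {a..R}"
    then have "0 < t" using \<open>0 < a\<close> by simp
    have "((\<lambda>t. f t * (1 / t powr (s - 1))) has_real_derivative ?g t) (at t)"
      by (rule DERIV_cong[OF DERIV_mult[OF f DERIV_inverse_powr[OF \<open>0 < t\<close>]]])
        (use t incr[of t] in \<open>simp add: d_def min_def algebra_simps\<close>)
    then show "((\<lambda>t. f t * (1 / t powr (s - 1))) has_vector_derivative ?g t) (at t within {a..R})"
      by (auto simp flip: has_real_derivative_iff_has_vector_derivative
          intro: has_field_derivative_at_within)
  qed (use assms in simp)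
  moreover
  have "(?g has_integral (- (f (2 * R - a) * (1 / (2 * R - (2 * R - a)) powr (s - 1))))
      - (- (f R * (1 / (2 * R - R) powr (s - 1))))) {R..2 * R - a}"
  proof (rule fundamental_theorem_of_calculus
      [where f = "\<lambda>t. - (f t * (1 / (2 * R - t) powr (s - 1)))"])
    fix t assume t: "t \<in> {R..2 * R - a}"
    then have dt: "d t = 2 * R - t" by (simp add: d_def)
    have abs_f': "\<bar>f' t\<bar> = - f' t" using decr[of t] t by simp
    have "0 < 2 * R - t" using t \<open>0 < a\<close> by simp
    have "((\<lambda>t. 1 / (2 * R - t) powr (s - 1)) has_real_derivative
        - ((s - 1) / (2 * R - t) powr s) * (- 1)) (at t)"
      by (rule DERIV_chain2[where f = "\<lambda>t. 1 / t powr (s - 1)" and g = "\<lambda>t. 2 * R - t",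
            OF DERIV_inverse_powr[OF \<open>0 < 2 * R - t\<close>]])
        (auto intro!: derivative_eq_intros)
    from DERIV_minus[OF DERIV_mult[OF f this]]
    have "((\<lambda>t. - (f t * (1 / (2 * R - t) powr (s - 1)))) has_real_derivative ?g t) (at t)"
      by (rule DERIV_cong) (simp add: dt abs_f' algebra_simps add_divide_distrib diff_divide_distrib)
    then show "((\<lambda>t. - (f t * (1 / (2 * R - t) powr (s - 1)))) has_vector_derivative ?g t)
        (at t within {R..2 * R - a})"
      by (auto simp flip: has_real_derivative_iff_has_vector_derivative
          intro: has_field_derivative_at_within)
  qed (use assms in simp)
  ultimately have "(?g has_integral (f R * (1 / R powr (s - 1)) - f a * (1 / a powr (s - 1)))
      + ((- (f (2 * R - a) * (1 / (2 * R - (2 * R - a)) powr (s - 1))))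
      - (- (f R * (1 / (2 * R - R) powr (s - 1)))))) {a..2 * R - a}"
    using assms by (intro has_integral_combine[where c = R]) auto
  then show ?thesis using assms by simp
qed

text \<open>The primitive \<open>ln X\<close> is zero at \<open>t = R\<close>. The double logarithm
  is unbounded as \<open>b\<close> tends to zero, which is the source of the failure at
  \<open>\<gamma> = 1\<close>.\<close>

lemma has_integral_X:
  assumes "0 < b" "b \<le> R"
  shows "((\<lambda>t. X (t / R) / t) has_integral ln (1 - ln (b / R))) {b..R}"
proof -
  have "((\<lambda>t. X (t / R) / t) has_integral ln (X (R / R)) - ln (X (b / R))) {b..R}"
  proof (rule fundamental_theorem_of_calculus[where f = "\<lambda>t. ln (X (t / R))"])
    fix t assume t: "t \<in> {b..R}"
    then have "0 < X (t / R)" using assms by (intro X_bounds) auto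
    then have "((\<lambda>t. ln (X (t / R))) has_real_derivative X (t / R) / t) (at t)"
      using DERIV_chain2[OF DERIV_ln_divide DERIV_X_scaled[of t R]] t assms
      by (simp add: power2_eq_square)
    then show "((\<lambda>t. ln (X (t / R))) has_vector_derivative X (t / R) / t) (at t within {b..R})"
      by (auto simp flip: has_real_derivative_iff_has_vector_derivative
          intro: has_field_derivative_at_within)
  qed (use assms in simp)
  then show ?thesis using assms by (simp add: X_def ln_inverse)
qed

lemma continuous_on_X_dist:
  assumes "0 < a" "a \<le> R"
  shows "continuous_on {a..2 * R - a} (\<lambda>t. X (min t (2 * R - t) / R))"
proof -
  have "1 - ln (min t (2 * R - t) / R) \<noteq> 0" if "t \<in> {a..2 * R - a}" for t
  proof -
    have "ln (min t (2 * R - t) / R) \<le> 0" using that assms by (auto simp: min_def)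
    then show ?thesis by linarith
  qed
  then show ?thesis
    unfolding X_def using assms by (intro continuous_intros) auto
qed

text \<open>Only the piece from \<open>b\<close> to \<open>R\<close> is kept, where
  \<open>d t = t\<close> and \<open>f\<close> is at least \<open>c\<close>; the integrand is
  nonnegative on the rest.\<close>

lemma integral_X_lower_bound:
  fixes f :: "real \<Rightarrow> real"
  assumes "0 < a" "a \<le> b" "b \<le> R" and cf: "continuous_on UNIV f"
    and f0: "\<And>t. 0 \<le> f t" and fc: "\<And>t. b \<le> t \<Longrightarrow> t \<le> R \<Longrightarrow> c \<le> f t"
  defines "d \<equiv> \<lambda>t. min t (2 * R - t)"
  shows "c * ln (1 - ln (b / R)) \<le> integral {a..2 * R - a} (\<lambda>t. f t / d t * X (d t / R))"
proof -
  let ?h = "\<lambda>t. f t / d t * X (d t / R)"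
  have cX: "continuous_on {a..2 * R - a} (\<lambda>t. X (d t / R))"
    unfolding d_def using assms by (intro continuous_on_X_dist) auto
  have "continuous_on {a..2 * R - a} (\<lambda>t. f t / d t)"
    unfolding d_def using assms
    by (intro continuous_intros continuous_on_subset[OF cf]) auto
  then have int: "?h integrable_on {a..2 * R - a}"
    by (intro integrable_continuous_real continuous_on_mult cX)
  have X0: "0 \<le> X (d t / R)" if "t \<in> {a..2 * R - a}" for t
    using that assms by (intro less_imp_le[OF X_bounds(1)]) (auto simp: d_def)
  have int': "?h integrable_on {b..R}"
    using assms by (intro integrable_on_subinterval[OF int]) auto
  have hi: "((\<lambda>t. c * (X (t / R) / t)) has_integral c * ln (1 - ln (b / R))) {b..R}"
    using assms by (intro has_integral_mult_right has_integral_X) auto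
  then have "c * ln (1 - ln (b / R)) = integral {b..R} (\<lambda>t. c * (X (t / R) / t))"
    by (simp only: integral_unique)
  also have "\<dots> \<le> integral {b..R} ?h"
  proof (rule integral_le)
    show "(\<lambda>t. c * (X (t / R) / t)) integrable_on {b..R}"
      using hi by blast
    fix t assume t: "t \<in> {b..R}"
    then have "0 \<le> X (t / R)" using X0[of t] assms by (simp add: d_def)
    then have "c * (X (t / R) / t) \<le> f t * (X (t / R) / t)"
      using fc[of t] t assms by (intro mult_right_mono) auto
    also have "\<dots> = ?h t" using t by (simp add: d_def min_def)
    finally show "c * (X (t / R) / t) \<le> ?h t" .
  qed (rule int')
  also have "\<dots> \<le> integral {a..2 * R - a} ?h"
  proof (rule integral_subset_le[OF _ int' int])
    show "{b..R} \<subseteq> {a..2 * R - a}" using assms by auto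
    show "\<forall>t\<in>{a..2 * R - a}. 0 \<le> ?h t"
      using X0 f0 assms(1) by (auto simp: d_def intro!: mult_nonneg_nonneg divide_nonneg_nonneg)
  qed
  finally show ?thesis .
qed

text \<open>Fubini's theorem for separated variables, to factor integrals over the cylinder that
  carries the test function.\<close>

lemma set_integral_product:
  fixes f :: "'a::euclidean_space \<Rightarrow> real" and g :: "'b::euclidean_space \<Rightarrow> real"
  assumes "compact A" "compact B" "continuous_on A f" "continuous_on B g"
  shows "set_integrable lborel (A \<times> B) (\<lambda>x. f (fst x) * g (snd x))"
    and "(LINT x:A \<times> B|lborel. f (fst x) * g (snd x)) = (LINT x:A|lborel. f x) * (LINT x:B|lborel. g x)"
proof -
  have "continuous_on (A \<times> B) (\<lambda>x. f (fst x) * g (snd x))"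
    by (intro continuous_intros continuous_on_compose2[OF assms(3)] continuous_on_compose2[OF assms(4)]) auto
  then show i: "set_integrable lborel (A \<times> B) (\<lambda>x. f (fst x) * g (snd x))"
    using borel_integrable_compact[OF compact_Times[OF assms(1,2)]] by (simp only: set_integrable_def)
  let ?F = "\<lambda>x. indicator (A \<times> B) x *\<^sub>R (f (fst x) * g (snd x))"
  have "(LINT x:A \<times> B|lborel. f (fst x) * g (snd x)) = integral\<^sup>L (lborel \<Otimes>\<^sub>M lborel) ?F"
    by (simp add: set_lebesgue_integral_def lborel_prod)
  also have "\<dots> = (\<integral>x. \<integral>y. ?F (x, y) \<partial>lborel \<partial>lborel)"
    using i by (subst lborel_pair.integral_fst') (simp_all add: set_integrable_def lborel_prod)
  also have "\<dots> = (\<integral>x. (indicator A x * f x) * (\<integral>y. indicator B y * g y \<partial>lborel) \<partial>lborel)"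
  proof (intro Bochner_Integration.integral_cong refl)
    fix x
    have "?F (x, y) = (indicator A x * f x) * (indicator B y * g y)" for y
      by (simp add: indicator_times)
    then show "(\<integral>y. ?F (x, y) \<partial>lborel) = (indicator A x * f x) * (\<integral>y. indicator B y * g y \<partial>lborel)"
      by (simp only: integral_mult_right_zero)
  qed
  also have "\<dots> = (LINT x:A|lborel. f x) * (LINT x:B|lborel. g x)"
    by (simp add: set_lebesgue_integral_def)
  finally show "(LINT x:A \<times> B|lborel. f (fst x) * g (snd x)) = (LINT x:A|lborel. f x) * (LINT x:B|lborel. g x)" .
qed

section \<open>The test functions: cutoff times profile\<close>

text \<open>The cutoff \<open>\<eta>(x'/L)\<close> of the overview; the squared norm keeps it smooth
  at the origin.\<close>

definition bump :: "real \<Rightarrow> 'a::euclidean_space \<Rightarrow> real" where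
  "bump L y = flat 1 (1 - (norm y)\<^sup>2 / L\<^sup>2)"

definition bump_grad :: "real \<Rightarrow> 'a::euclidean_space \<Rightarrow> 'a" where
  "bump_grad L y = (flat [:0, 0, 1:] (1 - (norm y)\<^sup>2 / L\<^sup>2) * (- (2 / L\<^sup>2))) *\<^sub>R y"

text \<open>The function \<open>f\<close> of the overview. For \<open>0 < a < R\<close> the
  quadratic factor is positive exactly between \<open>a\<close> and \<open>2 * R - a\<close> and
  symmetric about \<open>R\<close>; the factor \<open>2 / (a * R)\<close> makes the argument at
  least 1 from \<open>2 * a\<close> to \<open>R\<close>.\<close>

definition profile :: "real \<Rightarrow> real \<Rightarrow> real \<Rightarrow> real" where
  "profile R a t = flat 1 ((t - a) * (2 * R - a - t) * (2 / (a * R)))"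

definition profile_deriv :: "real \<Rightarrow> real \<Rightarrow> real \<Rightarrow> real" where
  "profile_deriv R a t =
     flat [:0, 0, 1:] ((t - a) * (2 * R - a - t) * (2 / (a * R))) * (2 * (R - t) * (2 / (a * R)))"

lemma flat_one_bounds: "0 \<le> flat 1 t" "flat 1 t \<le> 1"
  by (auto simp: flat_one)

lemma has_derivative_bump:
  "(bump L has_derivative (\<lambda>v. bump_grad L y \<bullet> v)) (at y)"
proof -
  have "((\<lambda>y. 1 - (norm y)\<^sup>2 * c) has_derivative (\<lambda>v. - (2 * (y \<bullet> v) * c))) (at y)" for c
    unfolding power2_norm_eq_inner
    by (auto intro!: derivative_eq_intros simp: inner_commute)
  from this[of "inverse (L\<^sup>2)"]
  have "((\<lambda>y. 1 - (norm y)\<^sup>2 / L\<^sup>2) has_derivative (\<lambda>v. - (2 * (y \<bullet> v) / L\<^sup>2))) (at y)"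
    by (simp add: divide_inverse)
  from has_derivative_compose[OF this DERIV_flat_one[unfolded has_field_derivative_def]]
  show ?thesis
    unfolding bump_def[abs_def] bump_grad_def
    by (rule has_derivative_eq_rhs) (simp add: fun_eq_iff)
qed

lemma bump_bounds: "0 \<le> bump L y" "bump L y \<le> 1"
  unfolding bump_def by (rule flat_one_bounds)+

lemma continuous_on_bump: "continuous_on A (bump L)"
  using has_derivative_bump by (meson differentiableI differentiable_at_withinI
      differentiable_imp_continuous_on differentiable_on_def)

lemma bump_eq_0:
  assumes "0 < L" "L \<le> norm y"
  shows "bump L y = 0"
proof -
  have "L\<^sup>2 \<le> (norm y)\<^sup>2" using assms by (intro power_mono) auto
  then show ?thesis using assms by (simp add: bump_def flat_one not_less)
qed

text \<open>On the half ball the argument of \<open>flat 1\<close> is at least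
  \<open>3 / 4\<close>.\<close>

lemma bump_ge:
  assumes "0 < L" "norm y \<le> L / 2"
  shows "exp (- (4 / 3)) \<le> bump L y"
proof -
  define r where "r = 1 - (norm y)\<^sup>2 / L\<^sup>2"
  have "(norm y)\<^sup>2 \<le> (L / 2)\<^sup>2" using assms by (intro power_mono) auto
  then have "3 / 4 \<le> r" using assms by (simp add: r_def field_simps power2_eq_square)
  then have "0 < r" "1 / r \<le> 4 / 3" by (auto simp: field_simps)
  then show ?thesis by (simp add: bump_def flat_one flip: r_def)
qed

text \<open>The factors are at most 2 (by \<open>flat_deriv_bounds\<close>),
  \<open>2 / L\<^sup>2\<close> and \<open>L\<close>. The decay in \<open>L\<close> makes the cutoff
  negligible.\<close>

lemma norm_bump_grad_le:
  assumes "0 < L" "norm y \<le> L"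
  shows "norm (bump_grad L y) \<le> 4 / L"
proof -
  have "norm (bump_grad L y) \<le> (2 * (2 / L\<^sup>2)) * L"
    unfolding bump_grad_def norm_scaleR abs_mult
    using assms flat_deriv_bounds by (intro mult_mono) auto
  also have "\<dots> = 4 / L" using assms by (simp add: power2_eq_square)
  finally show ?thesis .
qed

lemma C_k_bump: "C_k k (\<lambda>x :: 'a::euclidean_space \<times> 'b::euclidean_space. bump L (fst x))"
proof -
  have "C_k k (\<lambda>x :: 'a \<times> 'b. 1 + (- (1 / L\<^sup>2)) * (norm (fst x))\<^sup>2)" for k
    by (intro C_k_add C_k_mult C_k_const C_k_norm_fst_square)
  then show ?thesis
    unfolding bump_def by (intro C_k_flat) simp
qed

lemma DERIV_profile:
  "(profile R a has_real_derivative profile_deriv R a t) (at t)"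
  unfolding profile_def[abs_def] profile_deriv_def
proof (rule DERIV_chain2[OF DERIV_flat_one])
  show "((\<lambda>t. (t - a) * (2 * R - a - t) * (2 / (a * R))) has_real_derivative
      2 * (R - t) * (2 / (a * R))) (at t)"
    by (rule DERIV_cmult_right) (auto intro!: derivative_eq_intros simp: algebra_simps)
qed

lemma profile_bounds: "0 \<le> profile R a t" "profile R a t \<le> 1"
  unfolding profile_def by (rule flat_one_bounds)+

lemma profile_eq_0:
  assumes "0 < a" "a < R" "t \<le> a \<or> 2 * R - a \<le> t"
  shows "profile R a t = 0"
proof -
  have "(t - a) * (2 * R - a - t) \<le> 0"
    using assms by (auto simp: mult_le_0_iff)
  then show ?thesis
    using assms mult_nonpos_nonneg[of "(t - a) * (2 * R - a - t)" "2 / (a * R)"]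
    by (simp add: profile_def flat_one not_less)
qed

text \<open>Here \<open>t - a\<close> is at least \<open>a\<close> and \<open>2 * R - a - t\<close>
  at least \<open>R / 2\<close>, so the argument of \<open>flat 1\<close> is at least 1.\<close>

lemma profile_ge:
  assumes "0 < a" "2 * a \<le> t" "t \<le> R"
  shows "exp (- 1) \<le> profile R a t"
proof -
  define r where "r = (t - a) * (2 * R - a - t) * (2 / (a * R))"
  have "a * (R / 2) \<le> (t - a) * (2 * R - a - t)"
    using assms by (intro mult_mono) auto
  then have "1 \<le> r" using assms by (simp add: r_def field_simps)
  then have "0 < r" "1 / r \<le> 1" by auto
  then show ?thesis unfolding profile_def r_def[symmetric] by (simp add: flat_one)
qed

lemma profile_deriv_sign:
  assumes "0 < a" "0 < R"
  shows "t \<le> R \<Longrightarrow> 0 \<le> profile_deriv R a t" "R \<le> t \<Longrightarrow> profile_deriv R a t \<le> 0"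
proof -
  have "0 \<le> 2 / (a * R)" using assms by simp
  then show "t \<le> R \<Longrightarrow> 0 \<le> profile_deriv R a t" "R \<le> t \<Longrightarrow> profile_deriv R a t \<le> 0"
    unfolding profile_deriv_def
    by (intro mult_nonneg_nonneg mult_nonneg_nonpos mult_nonpos_nonneg flat_deriv_bounds; simp)+
qed

lemma continuous_on_profile: "continuous_on A (profile R a)"
  by (rule DERIV_continuous_on[OF has_field_derivative_at_within[OF DERIV_profile]])

lemma continuous_on_profile_deriv: "continuous_on A (profile_deriv R a)"
proof -
  have flat: "continuous_on UNIV (flat p)" for p
    by (rule DERIV_continuous_on[OF DERIV_flat])
  have "continuous_on A (\<lambda>t. flat p ((t - a) * (2 * R - a - t) * k) * (2 * (R - t) * k))" for p k
    by (intro continuous_intros continuous_on_compose2[OF flat]) auto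
  then show ?thesis unfolding profile_deriv_def .
qed

lemma C_k_profile: "C_k k (\<lambda>x :: 'a::euclidean_space \<times> real. profile R a (snd x))"
proof -
  have "C_k k (\<lambda>x :: 'a \<times> real. ((snd x + (- a)) * ((2 * R - a) + (- 1) * snd x)) * (2 / (a * R)))" for k
    by (intro C_k_add C_k_mult C_k_const C_k_linear bounded_linear_snd)
  then show ?thesis
    unfolding profile_def by (intro C_k_flat) simp
qed

definition hardy_test :: "real \<Rightarrow> real \<Rightarrow> real \<Rightarrow> 'a::euclidean_space \<times> real \<Rightarrow> real" where
  "hardy_test R a L x = bump L (fst x) * profile R a (snd x)"

lemma hardy_test_eq_0:
  assumes "0 < a" "a < R" "0 < L" "x \<notin> cball 0 L \<times> {a..2 * R - a}"
  shows "hardy_test R a L x = 0"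
proof -
  have "L \<le> norm (fst x) \<or> (snd x \<le> a \<or> 2 * R - a \<le> snd x)"
    using assms(4) by (cases x) auto
  then show ?thesis
    using bump_eq_0[of L "fst x"] profile_eq_0[of a R "snd x"] assms by (auto simp: hardy_test_def)
qed

lemma hardy_test_support:
  assumes "0 < a" "a < R" "0 < L"
  shows "closure {x :: 'a::euclidean_space \<times> real. hardy_test R a L x \<noteq> 0} \<subseteq> cball 0 L \<times> {a..2 * R - a}"
proof (rule closure_minimal)
  show "{x :: 'a \<times> real. hardy_test R a L x \<noteq> 0} \<subseteq> cball 0 L \<times> {a..2 * R - a}"
    using hardy_test_eq_0[OF assms] by blast
qed (intro closed_Times closed_cball closed_atLeastAtMost)

lemma hardy_test_in_test_functions:
  assumes "0 < a" "a < R" "0 < L"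
  shows "(hardy_test R a L :: (real ^ 'm) \<times> real \<Rightarrow> real) \<in> test_functions (strip R)"
proof -
  let ?u = "hardy_test R a L :: (real ^ 'm) \<times> real \<Rightarrow> real"
  have supp: "closure {x. ?u x \<noteq> 0} \<subseteq> cball 0 L \<times> {a..2 * R - a}"
    by (rule hardy_test_support[OF assms])
  have "bounded (closure {x. ?u x \<noteq> 0})"
    by (rule bounded_subset[OF _ supp]) (intro bounded_Times bounded_cball bounded_closed_interval)
  moreover have "cball 0 L \<times> {a..2 * R - a} \<subseteq> (strip R :: ((real ^ 'm) \<times> real) set)"
    using assms by (auto simp: strip_def)
  ultimately show ?thesis
    using supp unfolding test_functions_def
    by (auto simp: compact_eq_bounded_closed hardy_test_def[abs_def] intro!: C_k_mult C_k_bump C_k_profile)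
qed

lemma grad_hardy_test:
  "grad (hardy_test R a L) (y, t)
    = (profile R a t *\<^sub>R bump_grad L y, bump L y * profile_deriv R a t)"
proof (rule grad_eqI)
  have 1: "((\<lambda>x. bump L (fst x)) has_derivative (\<lambda>v. bump_grad L y \<bullet> fst v)) (at (y, t))"
    by (rule has_derivative_compose[where f = fst, of fst])
      (use has_derivative_bump[of L y] in \<open>auto intro!: derivative_eq_intros\<close>)
  have 2: "((\<lambda>x. profile R a (snd x)) has_derivative (\<lambda>v. profile_deriv R a t * snd v)) (at (y, t))"
    by (rule has_derivative_compose[where f = snd, of snd])
      (use DERIV_profile[of R a t] in \<open>auto intro!: derivative_eq_intros simp: has_field_derivative_def\<close>)
  show "(hardy_test R a L has_derivative
      (\<lambda>v. (profile R a t *\<^sub>R bump_grad L y, bump L y * profile_deriv R a t) \<bullet> v)) (at (y, t))"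
    unfolding hardy_test_def[abs_def]
    by (rule has_derivative_eq_rhs[OF has_derivative_mult[OF 1 2]])
      (auto simp: fun_eq_iff inner_prod_def algebra_simps)
qed

section \<open>Failure at \<open>\<gamma> = 1\<close>\<close>

text \<open>The half ball, where \<open>bump_ge\<close> applies, has the fraction
  \<open>1 / 2 ^ DIM('a)\<close> of the volume. The constant obtained does not depend on
  \<open>L\<close>.\<close>

lemma integral_bump_ge:
  assumes "0 < L"
  shows "exp (- (4 / 3)) / 2 ^ DIM('a) * measure lborel (cball (0 :: 'a::euclidean_space) L)
    \<le> (LINT y:cball (0 :: 'a) L|lborel. bump L y)"
proof -
  have "exp (- (4 / 3)) / 2 ^ DIM('a) * measure lborel (cball (0 :: 'a) L)
      = exp (- (4 / 3)) * measure lborel (cball (0 :: 'a) (L / 2))"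
    using assms by (simp add: content_cball power_divide)
  also have "\<dots> = (LINT y:cball (0 :: 'a) (L / 2)|lborel. exp (- (4 / 3)))"
    by (simp add: set_lebesgue_integral_def emeasure_lborel_cball_finite)
  also have "\<dots> \<le> (LINT y:cball (0 :: 'a) L|lborel. bump L y)"
    unfolding set_lebesgue_integral_def
  proof (rule integral_mono)
    show "integrable lborel (\<lambda>y. indicator (cball (0 :: 'a) (L / 2)) y *\<^sub>R exp (- (4 / 3) :: real))"
      "integrable lborel (\<lambda>y. indicator (cball (0 :: 'a) L) y *\<^sub>R bump L y)"
      by (intro borel_integrable_compact compact_cball continuous_on_bump continuous_intros)+
    show "indicator (cball 0 (L / 2)) y *\<^sub>R exp (- (4 / 3)) \<le> indicator (cball 0 L) y *\<^sub>R bump L y" for y :: 'a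
      using bump_ge[of L y] bump_bounds[of L y] assms by (auto simp: indicator_def)
  qed
  finally show ?thesis .
qed

text \<open>On one line, left side minus right side has the negative integral \<open>J\<close> for
  the profile. On the strip \<open>J\<close> is multiplied by at least a fixed fraction of the
  volume of the ball of radius \<open>L\<close>, while the cutoff costs only \<open>O(1 / L)\<close>
  times that volume.\<close>

lemma hardy_strip_log_fails:
  assumes "0 < R" "0 < C"
  shows "\<exists>u \<in> test_functions (strip R :: ((real ^ 'm) \<times> real) set). \<not> hardy_strip_ineq R s 1 C u"
proof -
  \<comment> \<open>\<open>a\<close> is chosen such that the logarithmic term of the profile is at least \<open>C N / e > 2\<close>.\<close>
  define N where "N = 2 * exp 1 / C + 1"
  define a where "a = R * exp (1 - exp N) / 2"
  have "0 < N" using assms by (simp add: N_def add_pos_pos)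
  then have "R * exp (1 - exp N) \<le> R * 1" using assms by (intro mult_left_mono) auto
  moreover have "0 < R * exp (1 - exp N)" using assms by simp
  ultimately have a: "0 < a" "2 * a \<le> R" "a < R"
    using assms unfolding a_def by linarith+
  \<comment> \<open>As \<open>2 * a / R\<close> equals \<open>exp (1 - exp N)\<close>, the double
    logarithm undoes both exponentials.\<close>
  have ln_a: "ln (1 - ln (2 * a / R)) = N"
    using assms by (simp add: a_def)
  define f where "f = profile R a"
  define f' where "f' = profile_deriv R a"
  define d where "d = (\<lambda>t. min t (2 * R - t))"
  define I where "I = {a..2 * R - a}"
  define h where "h t = f t / d t * X (d t / R)" for t
  \<comment> \<open>\<open>g\<close> is the density of left side minus right side on one line;
    \<open>w\<close> below weighs the gradient of the cutoff in \<open>x'\<close>.\<close>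
  define g where "g t = \<bar>f' t\<bar> / d t powr (s - 1) - (s - 1) * (f t / d t powr s)
    - C / R powr (s - 1) * h t" for t
  define w where "w t = f t / d t powr (s - 1)" for t
  have f_bounds: "0 \<le> f t" "f t \<le> 1" for t
    unfolding f_def by (rule profile_bounds)+
  have d_pos: "0 < d t" "d t \<le> R" if "t \<in> I" for t
    using that a by (auto simp: d_def I_def)
  have cf: "continuous_on A f" "continuous_on A f'" "continuous_on A d" for A
    unfolding f_def f'_def d_def
    by (intro continuous_on_profile continuous_on_profile_deriv continuous_intros)+
  have cX: "continuous_on I (\<lambda>t. X (d t / R))"
    unfolding I_def d_def using a by (intro continuous_on_X_dist) auto
  have d_neq0: "d t \<noteq> 0" if "t \<in> I" for t using d_pos[OF that] by simp
  have ch: "continuous_on I h"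
    unfolding h_def by (intro continuous_intros cf cX) (use d_neq0 in blast)
  have cg: "continuous_on I g"
    unfolding g_def by (intro continuous_intros cf ch) (use d_neq0 in auto)
  have cw: "continuous_on I w"
    unfolding w_def by (intro continuous_intros cf) (use d_neq0 in auto)
  have "compact I" by (simp add: I_def)

  define J where "J = (LINT t:I|lborel. g t)"
  have "J < 0"
  proof -
    have "J = integral I g"
      unfolding J_def using borel_integrable_compact[OF \<open>compact I\<close> cg]
      by (intro set_borel_integral_eq_integral) (simp only: set_integrable_def)
    also have "\<dots> = 2 * (f R / R powr (s - 1)) - C / R powr (s - 1) * integral I h"
    proof (rule integral_unique)
      have "((\<lambda>t. \<bar>f' t\<bar> / d t powr (s - 1) - (s - 1) * (f t / d t powr s))
          has_integral 2 * (f R / R powr (s - 1))) I"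
        unfolding I_def d_def using a assms
        by (intro hardy_difference_has_integral)
          (auto simp: f_def f'_def DERIV_profile profile_eq_0 profile_deriv_sign)
      moreover have "(h has_integral integral I h) I"
        using ch unfolding I_def by (intro integrable_integral integrable_continuous_real)
      ultimately show "(g has_integral
          2 * (f R / R powr (s - 1)) - C / R powr (s - 1) * integral I h) I"
        unfolding g_def by (intro has_integral_diff has_integral_mult_right)
    qed
    also have "\<dots> = (2 * f R - C * integral I h) / R powr (s - 1)"
      by (simp add: diff_divide_distrib)
    also have "\<dots> < 0"
    proof (rule divide_neg_pos)
      \<comment> \<open>The lower bound is taken with \<open>b = 2 * a\<close> and
        \<open>c = exp (- 1)\<close>, the values of \<open>profile_ge\<close>.\<close>
      have "exp (- 1) * ln (1 - ln (2 * a / R)) \<le> integral I h"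
        unfolding h_def I_def d_def using a f_bounds cf profile_ge[of a _ R]
        by (intro integral_X_lower_bound) (auto simp: f_def)
      then have "C * (exp (- 1) * N) \<le> C * integral I h"
        using assms unfolding ln_a by (intro mult_left_mono) auto
      moreover have "C * (exp (- 1) * N) = 2 + C * exp (- 1)"
        using assms by (simp add: N_def exp_minus field_simps)
      moreover have "0 < C * exp (- 1)" using assms by simp
      ultimately show "2 * f R - C * integral I h < 0"
        using f_bounds(2)[of R] by linarith
    qed (use assms in simp)
    finally show ?thesis .
  qed

  define W where "W = (LINT t:I|lborel. w t)"
  have "0 \<le> W"
    unfolding W_def set_lebesgue_integral_def
    by (rule Bochner_Integration.integral_nonneg) (auto simp: w_def f_bounds)
  \<comment> \<open>The factor of \<open>- J\<close> is the constant of
    \<open>integral_bump_ge\<close>, so the main term is at most \<open>- c\<close> times the volume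
    of the ball.\<close>
  define c where "c = exp (- (4 / 3)) / 2 ^ CARD('m) * - J"
  have "0 < c" unfolding c_def using \<open>J < 0\<close> by (intro mult_pos_pos divide_pos_pos) auto
  \<comment> \<open>The gradient of the cutoff in \<open>x'\<close> contributes \<open>O(1 / L)\<close> relative to the main term.\<close>
  define L where "L = 4 * W / c + 1"
  have "0 < L" using \<open>0 \<le> W\<close> \<open>0 < c\<close> by (simp add: L_def add_nonneg_pos)
  have "4 * W / L < c"
    using \<open>0 < L\<close> \<open>0 < c\<close> by (simp add: L_def field_simps)

  define u :: "(real ^ 'm) \<times> real \<Rightarrow> real" where "u = hardy_test R a L"
  define S where "S = (strip R :: ((real ^ 'm) \<times> real) set)"
  define K where "K = cball (0 :: real ^ 'm) L \<times> I"
  have u: "u \<in> test_functions S"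
    unfolding u_def S_def using a \<open>0 < L\<close> by (intro hardy_test_in_test_functions)
  have "K \<subseteq> S" using a by (auto simp: K_def I_def S_def strip_def)
  note int = hardy_strip_integrable[OF u[unfolded S_def], folded S_def]
  define E where "E x = norm (grad u x) / bdist S x powr (s - 1)
    - (s - 1) * (\<bar>u x\<bar> / bdist S x powr s)
    - C / R powr (s - 1) * (\<bar>u x\<bar> / bdist S x * X (bdist S x / R) powr 1)" for x
  have int2: "set_integrable lborel S (\<lambda>x. (s - 1) * (\<bar>u x\<bar> / bdist S x powr s))"
    and int3: "set_integrable lborel S
      (\<lambda>x. C / R powr (s - 1) * (\<bar>u x\<bar> / bdist S x * X (bdist S x / R) powr 1))"
    by (intro set_integrable_mult_right int)+
  have iE: "set_integrable lborel S E"
    unfolding E_def by (intro set_integral_diff int int2 int3)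
  \<comment> \<open>A majorant of \<open>E\<close> that is a sum of two products in separated
    variables; \<open>4 / L\<close> comes from \<open>norm_bump_grad_le\<close>.\<close>
  define B where "B x = bump L (fst x) * g (snd x) + (4 / L) * w (snd x)" for x :: "(real ^ 'm) \<times> real"
  have E_le: "indicator S x * E x \<le> indicator K x * B x" for x
  proof (cases "x \<in> K")
    case True
    then obtain y t where x: "x = (y, t)" "norm y \<le> L" "t \<in> I"
      by (auto simp: K_def)
    have "(y, t) \<in> S" using True \<open>K \<subseteq> S\<close> x by auto
    have dt: "bdist S (y, t) = d t"
      using x a by (simp add: S_def d_def I_def bdist_strip)
    \<comment> \<open>Positivity allows \<open>X (d t / R) powr 1\<close> to be read as
      \<open>X (d t / R)\<close>.\<close>
    have X0: "0 < X (d t / R)" using d_pos[OF x(3)] assms by (intro X_bounds) auto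
    have u_eq: "\<bar>u (y, t)\<bar> = bump L y * f t"
      using bump_bounds(1)[of L y] f_bounds(1)[of t] by (simp add: u_def hardy_test_def f_def)
    have "norm (grad u (y, t)) \<le> f t * norm (bump_grad L y) + bump L y * \<bar>f' t\<bar>"
      unfolding u_def grad_hardy_test
      by (rule order_trans[OF norm_Pair_le]) (use bump_bounds(1)[of L y] f_bounds(1)[of t] in
        \<open>simp add: abs_mult f_def f'_def\<close>)
    also have "\<dots> \<le> f t * (4 / L) + bump L y * \<bar>f' t\<bar>"
      using norm_bump_grad_le[OF \<open>0 < L\<close> x(2)] f_bounds(1)[of t]
      by (intro add_right_mono mult_left_mono)
    finally have "norm (grad u (y, t)) / d t powr (s - 1)
        \<le> (f t * (4 / L) + bump L y * \<bar>f' t\<bar>) / d t powr (s - 1)"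
      by (intro divide_right_mono) auto
    then have "E (y, t) \<le> B (y, t)"
      using X0 by (simp add: E_def B_def g_def w_def h_def dt u_eq algebra_simps add_divide_distrib)
    then show ?thesis using True \<open>(y, t) \<in> S\<close> x by simp
  next
    case False
    then have "x \<notin> closure {x. u x \<noteq> 0}"
      using hardy_test_support[OF a(1,3) \<open>0 < L\<close>] by (auto simp: u_def K_def I_def)
    then have "u x = 0" "grad u x = 0" by (rule test_function_vanishes[OF u])+
    then show ?thesis using False by (simp add: E_def)
  qed
  have cb: "continuous_on (cball (0 :: real ^ 'm) L) (bump L)"
    by (rule continuous_on_bump)
  note p1 = set_integral_product[OF compact_cball \<open>compact I\<close> cb cg, folded K_def]
  note p2 = set_integral_product[OF compact_cball[of "0 :: real ^ 'm" L] \<open>compact I\<close> continuous_on_const[of _ "4 / L"] cw, folded K_def]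
  have iB: "set_integrable lborel K B"
    unfolding B_def by (intro set_integral_add p1(1) p2(1))
  let ?V = "measure lborel (cball (0 :: real ^ 'm) L)"
  have "0 < ?V" using \<open>0 < L\<close> by (simp add: content_cball)
  have "(LINT x:S|lborel. E x) \<le> (LINT x:K|lborel. B x)"
    unfolding set_lebesgue_integral_def
    using iE iB E_le by (intro integral_mono) (simp_all add: set_integrable_def)
  also have "\<dots> = (LINT y:cball (0 :: real ^ 'm) L|lborel. bump L y) * J
      + (LINT y:cball (0 :: real ^ 'm) L|lborel. 4 / L) * W"
    unfolding B_def by (subst set_integral_add(2)[OF p1(1) p2(1)]) (simp only: p1(2) p2(2) J_def W_def)
  also have "(LINT y:cball (0 :: real ^ 'm) L|lborel. 4 / L) = 4 / L * ?V"
    by (simp add: set_lebesgue_integral_def emeasure_lborel_cball_finite)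
  \<comment> \<open>Since \<open>J\<close> is negative, the lower bound on the integral of the bump
    turns into an upper bound.\<close>
  also have "(LINT y:cball (0 :: real ^ 'm) L|lborel. bump L y) * J
      \<le> (exp (- (4 / 3)) / 2 ^ CARD('m) * ?V) * J"
    using integral_bump_ge[OF \<open>0 < L\<close>, where 'a = "real ^ 'm"] \<open>J < 0\<close>
    by (intro mult_right_mono_neg) auto
  also have "(exp (- (4 / 3)) / 2 ^ CARD('m) * ?V) * J + 4 / L * ?V * W = (4 * W / L - c) * ?V"
    by (simp add: c_def algebra_simps)
  also have "\<dots> < 0"
    using \<open>4 * W / L < c\<close> \<open>0 < ?V\<close> by (intro mult_neg_pos) auto
  finally have "(LINT x:S|lborel. E x) < 0" by simp
  moreover have "(LINT x:S|lborel. E x) = (LINT x:S|lborel. norm (grad u x) / bdist S x powr (s - 1))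
      - (s - 1) * (LINT x:S|lborel. \<bar>u x\<bar> / bdist S x powr s)
      - C / R powr (s - 1) * (LINT x:S|lborel. \<bar>u x\<bar> / bdist S x * X (bdist S x / R) powr 1)"
    unfolding E_def
    by (simp only: set_integral_diff(2)[OF set_integral_diff(1)[OF int(1) int2] int3]
        set_integral_diff(2)[OF int(1) int2] set_integral_mult_right)
  ultimately have "\<not> hardy_strip_ineq R s 1 C u"
    unfolding hardy_strip_ineq_def Let_def S_def[symmetric] by linarith
  then show ?thesis using u unfolding S_def by blast
qed

text \<open>The witness in the first part is \<open>\<gamma> - 1\<close> itself.\<close>

theorem mainTheorem5:
  fixes R s :: real
  assumes "R > 0" and "s \<ge> 1"
  shows "(\<forall>\<gamma>>1. \<exists>C\<ge>\<gamma> - 1.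
            \<forall>u \<in> test_functions (strip R :: ((real ^ 'm) \<times> real) set). hardy_strip_ineq R s \<gamma> C u) \<and>
         \<not> (\<exists>C>0.
            \<forall>u \<in> test_functions (strip R :: ((real ^ 'm) \<times> real) set). hardy_strip_ineq R s 1 C u)"
  using hardy_strip[OF \<open>s \<ge> 1\<close>] hardy_strip_log_fails[OF \<open>R > 0\<close>] by blast

end
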